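(* Let $(f,V)$ and $(g,W)$ be symplectic root systems over $\mathbb{F}_2$ on the same graph $\mathcal{G}$, and assume that $(f,V)$ is minimal. Then there exists a unique homomorphism of symplectic root systems $\phi:(f,V)\rightarrow(g,W)$. In particular, two minimal symplectic root systems on the same graph are always isomorphic.
   Context: Graphs are finite, undirected, without loops or multiple edges; vector spaces are finite-dimensional. A symplectic vector space over a field $\Bbbk$ is a $\Bbbk$-vector space $V$ with a (possibly degenerate) bilinear form $\langle,\rangle:V\times V\to\Bbbk$ such that $\langle v,v\rangle=0$ for all $v\in V$. A symplectic root system $F=(f,V)$ over $\mathbb{F}_2$ on a graph $\mathcal{G}$ consists of a symplectic vector space $V$ over $\mathbb{F}_2$ and a map $f$ from the nodes of $\mathcal{G}$ to $V$ such that the image $f(\mathcal{G})$ generates $V$, and two nodes $\alpha,\beta$ are adjacent in $\mathcal{G}$ if and only if $\langle f(\alpha),f(\beta)\rangle\neq 0$. It is minimal if the family $\{f(\alpha)\}_{\alpha\in\mathcal{G}}$ is a basis of $V$. A homomorphism of symplectic root systems $\phi:(f,V)\to(g,W)$ on the same graph is a linear map $\phi:V\to W$ with $\phi\circ f=g$; it is an isomorphism if $\phi$ is bijective. *)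

theory Defs
  imports "HOL-Library.Z2" "Graph_Theory.Digraph"
begin

text \<open>
  The vector space \<open>V\<close> is the whole type \<open>'v\<close> with scalar multiplication \<open>scale\<close>.
  The form may be degenerate.
\<close>

locale symplectic_vector_space = vector_space scale
  for scale :: "'k::field \<Rightarrow> 'v::ab_group_add \<Rightarrow> 'v" +
  fixes form :: "'v \<Rightarrow> 'v \<Rightarrow> 'k"
  assumes finite_dimensional: "\<exists>Basis. finite_dimensional_vector_space scale Basis"
    and linear_left: "\<And>y. Vector_Spaces.linear scale (*) (\<lambda>x. form x y)"
    and linear_right: "\<And>x. Vector_Spaces.linear scale (*) (\<lambda>y. form x y)"
    and alternating: "\<And>x. form x x = 0"

text \<open>
  The field with two elements is the type \<open>bit\<close>. A finite simple graph is an instance of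
  the locale \<open>graph\<close>, in which an undirected edge is a pair of opposite arcs. Only the
  values of \<open>f\<close> on \<open>verts G\<close> are relevant.
\<close>

locale symplectic_root_system =
  graph G + symplectic_vector_space scale form
  for G :: "('a, 'b) pre_digraph"
    and scale :: "bit \<Rightarrow> 'v::ab_group_add \<Rightarrow> 'v"
    and form :: "'v \<Rightarrow> 'v \<Rightarrow> bit" +
  fixes f :: "'a \<Rightarrow> 'v"
  assumes generates: "span (f ` verts G) = UNIV"
    and adjacent_iff: "\<And>\<alpha> \<beta>. \<alpha> \<in> verts G \<Longrightarrow> \<beta> \<in> verts G \<Longrightarrow>
      \<alpha> \<rightarrow>\<^bsub>G\<^esub> \<beta> \<longleftrightarrow> form (f \<alpha>) (f \<beta>) \<noteq> 0"

text \<open>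
  Injectivity is needed because the family, not just its image, has to be a basis;
  that it spans is \<open>generates\<close>.
\<close>

locale minimal_symplectic_root_system = symplectic_root_system +
  assumes family_inj: "inj_on f (verts G)"
    and family_independent: "independent (f ` verts G)"

definition srs_hom ::
  "('a, 'b) pre_digraph \<Rightarrow>
   (bit \<Rightarrow> 'v::ab_group_add \<Rightarrow> 'v) \<Rightarrow> ('a \<Rightarrow> 'v) \<Rightarrow>
   (bit \<Rightarrow> 'w::ab_group_add \<Rightarrow> 'w) \<Rightarrow> ('a \<Rightarrow> 'w) \<Rightarrow> ('v \<Rightarrow> 'w) \<Rightarrow> bool"
  where "srs_hom G scaleV f scaleW g \<phi> \<longleftrightarrow>
    Vector_Spaces.linear scaleV scaleW \<phi> \<and> (\<forall>\<alpha>\<in>verts G. \<phi> (f \<alpha>) = g \<alpha>)"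

definition srs_iso ::
  "('a, 'b) pre_digraph \<Rightarrow>
   (bit \<Rightarrow> 'v::ab_group_add \<Rightarrow> 'v) \<Rightarrow> ('a \<Rightarrow> 'v) \<Rightarrow>
   (bit \<Rightarrow> 'w::ab_group_add \<Rightarrow> 'w) \<Rightarrow> ('a \<Rightarrow> 'w) \<Rightarrow> ('v \<Rightarrow> 'w) \<Rightarrow> bool"
  where "srs_iso G scaleV f scaleW g \<phi> \<longleftrightarrow> srs_hom G scaleV f scaleW g \<phi> \<and> bij \<phi>"

end

theory Submission
  imports Defs
begin

text \<open>A homomorphism out of (f, V) is a linear map with prescribed values on the family
  \<open>f\<close>. The family spans V, so there is at most one such map
  (\<open>srs_hom_unique\<close>); if it is a basis, any prescription on the nodes extends linearly,
  so there is one (\<open>srs_hom_exists\<close>). A minimal system is thus initial among the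
  systems on its graph, and two minimal ones are isomorphic by the usual argument for initial
  objects.\<close>

lemma srs_hom_unique:
  assumes "symplectic_root_system G scaleV formV f" "vector_space scaleW"
    and "srs_hom G scaleV f scaleW g \<phi>" "srs_hom G scaleV f scaleW g \<psi>"
  shows "\<phi> = \<psi>"
proof
  interpret V: symplectic_root_system G scaleV formV f by fact
  interpret W: vector_space scaleW by fact
  interpret vector_space_pair scaleV scaleW ..
  fix x
  show "\<phi> x = \<psi> x"
  proof (rule linear_eq_on)
    \<comment> \<open>The span is the whole type, so agreement on the nodes forces equality of
      functions everywhere.\<close>
    show "x \<in> V.span (f ` verts G)"
      by (simp add: V.generates)
  next
    fix b assume "b \<in> f ` verts G"
    then obtain \<alpha> where "\<alpha> \<in> verts G" "b = f \<alpha>" ..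
    then show "\<phi> b = \<psi> b"
      using assms(3,4) by (simp add: srs_hom_def)
  qed (use assms(3,4) in \<open>unfold srs_hom_def, blast+\<close>)
qed

lemma srs_hom_exists:
  assumes "minimal_symplectic_root_system G scaleV formV f" "vector_space scaleW"
  shows "\<exists>\<phi>. srs_hom G scaleV f scaleW g \<phi>"
proof -
  interpret V: minimal_symplectic_root_system G scaleV formV f by fact
  interpret W: vector_space scaleW by fact
  interpret vector_space_pair scaleV scaleW ..
  \<comment> \<open>Linear extension starts from values on a set of vectors, whereas
    \<open>g\<close> is indexed by nodes. Going back along \<open>f\<close> translates between the
    two; injectivity of the family ensures that each basis vector comes from a single node.\<close>
  obtain \<phi> where lin: "Vector_Spaces.linear scaleV scaleW \<phi>"
    and \<phi>: "\<forall>x\<in>f ` verts G. \<phi> x = (g \<circ> the_inv_into (verts G) f) x"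
    using linear_independent_extend[OF V.family_independent] by blast
  have "\<phi> (f \<alpha>) = g \<alpha>" if "\<alpha> \<in> verts G" for \<alpha>
    using \<phi> that by (simp add: the_inv_into_f_f[OF V.family_inj])
  with lin show ?thesis
    unfolding srs_hom_def by blast
qed

lemma srs_hom_id:
  assumes "vector_space scaleV"
  shows "srs_hom G scaleV f scaleV f id"
  using vector_space.linear_id[OF assms] by (simp add: srs_hom_def)

lemma srs_hom_comp:
  assumes "srs_hom G scaleV f scaleW g \<phi>" "srs_hom G scaleW g scaleU h \<psi>"
  shows "srs_hom G scaleV f scaleU h (\<psi> \<circ> \<phi>)"
  using assms by (auto simp: srs_hom_def intro: Vector_Spaces.linear_compose)

theorem corollary3p9:
  fixes G :: "('a, 'b) pre_digraph"
    and scaleV :: "bit \<Rightarrow> 'v::ab_group_add \<Rightarrow> 'v" and formV :: "'v \<Rightarrow> 'v \<Rightarrow> bit" and f :: "'a \<Rightarrow> 'v"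
    and scaleW :: "bit \<Rightarrow> 'w::ab_group_add \<Rightarrow> 'w" and formW :: "'w \<Rightarrow> 'w \<Rightarrow> bit" and g :: "'a \<Rightarrow> 'w"
  assumes "minimal_symplectic_root_system G scaleV formV f"
    and "symplectic_root_system G scaleW formW g"
  shows "(\<exists>!\<phi>. srs_hom G scaleV f scaleW g \<phi>) \<and>
    (minimal_symplectic_root_system G scaleW formW g \<longrightarrow> (\<exists>\<phi>. srs_iso G scaleV f scaleW g \<phi>))"
proof (intro conjI impI)
  interpret V: minimal_symplectic_root_system G scaleV formV f by fact
  interpret W: symplectic_root_system G scaleW formW g by fact
  note vs = V.vector_space_axioms W.vector_space_axioms
  note srs = V.symplectic_root_system_axioms W.symplectic_root_system_axioms
  obtain \<phi> where \<phi>: "srs_hom G scaleV f scaleW g \<phi>"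
    using srs_hom_exists[OF assms(1) vs(2)] by blast
  then show "\<exists>!\<phi>. srs_hom G scaleV f scaleW g \<phi>"
    using srs_hom_unique[OF srs(1) vs(2)] by blast
  assume "minimal_symplectic_root_system G scaleW formW g"
  \<comment> \<open>Minimality of (g, W) provides a homomorphism in the opposite direction.\<close>
  then obtain \<psi> where \<psi>: "srs_hom G scaleW g scaleV f \<psi>"
    using srs_hom_exists[OF _ vs(1)] by blast
  \<comment> \<open>The composite and the identity are both endomorphisms of (f, V), so uniqueness
    identifies them; the other composite is treated likewise on (g, W).\<close>
  have "\<psi> \<circ> \<phi> = id"
    using srs_hom_unique[OF srs(1) vs(1) srs_hom_comp[OF \<phi> \<psi>] srs_hom_id[OF vs(1)]] .
  moreover have "\<phi> \<circ> \<psi> = id"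
    using srs_hom_unique[OF srs(2) vs(2) srs_hom_comp[OF \<psi> \<phi>] srs_hom_id[OF vs(2)]] .
  ultimately have "bij \<phi>"
    by (rule o_bij)
  with \<phi> show "\<exists>\<phi>. srs_iso G scaleV f scaleW g \<phi>"
    by (auto simp: srs_iso_def)
qed

end
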